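(* Let $q$ be a power of a prime $p$, and let $w_1<w_2$ be the non-zero weights of a non-repetitive (full-length) $[n,k]_q$ two-weight code $C$ without full support. Then there exist integers $f$ and $u$ such that $w_1=up^f$ and $w_2=(u+1)p^f$.
   Context: An $[n,k]_q$-code is a $k$-dimensional linear subspace $C$ of $\mathbb{F}_q^n$. The weight of a codeword is its number of non-zero coordinates. $C$ is a two-weight code if the non-zero codewords attain exactly two different weights. $C$ is of full length if no coordinate is zero on all of $C$, equivalently all columns of a generator matrix are non-zero. Codes are assumed to be of full length. Codes are considered equivalent if they differ by a permutation of coordinates and multiplication of coordinates by non-zero scalars. To a full-length $[n,k]_q$-code $C$ with generator matrix $G$ one associates the multiset of points $\mathcal{M}\colon\mathcal{P}\to\mathbb{N}$ in $\operatorname{PG}(k-1,q)$, where $\mathcal{P}$ is the set of $1$-dimensional subspaces of $\mathbb{F}_q^k$ and $\mathcal{M}(P)$ is the number of columns of $G$ that span $P$. The code $C$ has full support if $\mathcal{M}(P)>0$ for all $P\in\mathcal{P}$. The code $C$ is repetitive if (up to equivalence) it is the $l$-fold repetition of an $[n/l,k]_q$-code for some integer $l>1$, equivalently if the greatest common divisor of all point multiplicities $\mathcal{M}(P)$, $P\in\mathcal{P}$, is larger than one; otherwise $C$ is non-repetitive. *)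

theory Defs
  imports "HOL-Library.Cardinality" "HOL-Computational_Algebra.Primes" "Jordan_Normal_Form.VS_Connect" "HOL-Combinatorics.Permutations"
begin

text \<open>
  Vectors of \<open>F_q^n\<close> are elements of \<^term>\<open>carrier_vec n\<close> over a finite field type of
  cardinality \<open>q\<close>, so that \<open>n\<close> and \<open>k\<close> are ordinary natural numbers.
\<close>

definition lin_subspace :: "nat \<Rightarrow> nat \<Rightarrow> 'a::field vec set \<Rightarrow> bool" where
  "lin_subspace n k W \<longleftrightarrow>
     VectorSpace.subspace class_ring W (module_vec TYPE('a) n) \<and>
     vectorspace.dim class_ring ((module_vec TYPE('a) n) \<lparr>carrier := W\<rparr>) = k"

abbreviation linear_code :: "nat \<Rightarrow> nat \<Rightarrow> 'a::field vec set \<Rightarrow> bool" where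
  "linear_code \<equiv> lin_subspace"

definition weight :: "'a::zero vec \<Rightarrow> nat" where
  "weight c = card {i. i < dim_vec c \<and> c $ i \<noteq> 0}"

definition nonzero_weights :: "nat \<Rightarrow> 'a::zero vec set \<Rightarrow> nat set" where
  "nonzero_weights n C = weight ` (C - {0\<^sub>v n})"

definition two_weight_code :: "nat \<Rightarrow> 'a::zero vec set \<Rightarrow> bool" where
  "two_weight_code n C \<longleftrightarrow> card (nonzero_weights n C) = 2"

definition full_length :: "nat \<Rightarrow> 'a::zero vec set \<Rightarrow> bool" where
  "full_length n C \<longleftrightarrow> (\<forall>i<n. \<exists>c\<in>C. c $ i \<noteq> 0)"

text \<open>
  For a \<open>k\<close>-dimensional code the \<open>k\<close> rows of a generator matrix, spanning \<open>C\<close>,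
  automatically form a basis of \<open>C\<close>.
\<close>

definition generator_matrix :: "nat \<Rightarrow> nat \<Rightarrow> 'a::field mat \<Rightarrow> 'a vec set \<Rightarrow> bool" where
  "generator_matrix n k G C \<longleftrightarrow>
     linear_code n k C \<and> G \<in> carrier_mat k n \<and> vec_space.row_space n G = C"

text \<open>The points of \<open>PG(k-1,q)\<close>, as sets of vectors.\<close>

definition pg_points :: "nat \<Rightarrow> 'a::field vec set set" where
  "pg_points k = {P. lin_subspace k 1 P}"

definition point_multiplicity :: "'a::field mat \<Rightarrow> 'a vec set \<Rightarrow> nat" where
  "point_multiplicity G P =
     card {j. j < dim_col G \<and>
       LinearCombinations.module.span class_ring (module_vec TYPE('a) (dim_row G)) {col G j} = P}"

text \<open>
  Generator matrices of the same code differ by an invertible matrix on the left, which permutes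
  the points; hence this is a property of the code generated by \<open>G\<close>.
\<close>

definition full_support :: "'a::field mat \<Rightarrow> bool" where
  "full_support G \<longleftrightarrow> (\<forall>P\<in>pg_points (dim_row G). point_multiplicity G P > 0)"

definition code_equivalent :: "nat \<Rightarrow> 'a::field vec set \<Rightarrow> 'a vec set \<Rightarrow> bool" where
  "code_equivalent n C D \<longleftrightarrow>
     (\<exists>\<pi> a. \<pi> permutes {..<n} \<and> (\<forall>i<n. a i \<noteq> 0) \<and>
        D = (\<lambda>c. vec n (\<lambda>i. a i * c $ \<pi> i)) ` C)"

text \<open>The concatenation \<open>(c | c | \<dots> | c)\<close> of \<open>l\<close> copies of \<open>c\<close>.\<close>

definition repeat_vec :: "nat \<Rightarrow> 'a vec \<Rightarrow> 'a vec" where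
  "repeat_vec l c = vec (l * dim_vec c) (\<lambda>i. c $ (i mod dim_vec c))"

definition repetitive :: "nat \<Rightarrow> nat \<Rightarrow> 'a::field vec set \<Rightarrow> bool" where
  "repetitive n k C \<longleftrightarrow>
     (\<exists>l>1. \<exists>m C'. n = l * m \<and> linear_code m k C' \<and> code_equivalent n C (repeat_vec l ` C'))"

end

theory Submission
  imports Defs "HOL-Library.Product_Plus"
begin

text \<open>
  Let \<open>q\<close> be the order of the field, \<open>d = w2 - w1\<close>, and let \<open>N v\<close> be the number of columns of the
  generator matrix that are proportional to a non-zero vector \<open>v\<close>, i.e. the multiplicity of the point
  spanned by \<open>v\<close>. The weight of the codeword of a message \<open>x\<close> is the number of columns not orthogonal
  to \<open>x\<close>. With \<open>c = q ^ (k - 2)\<close>, summing the weights over the affine hyperplane \<open>v \<bullet> x = 1\<close> in two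
  ways gives
    \<open>w1 * q * c + d * b v = n * (q - 1) * c + N v * c\<close>,
  where \<open>b v\<close> counts the messages of weight \<open>w2\<close> on this hyperplane. The left side is the two-weight
  property; the right side is a double count over the columns (\<open>weight_sum_affine_hyperplane\<close>).

  As the code does not have full support, some \<open>v0\<close> satisfies \<open>N v0 = 0\<close>. Subtracting its equation
  from that of \<open>v\<close> shows that \<open>d\<close> divides \<open>N v * c\<close> for every \<open>v\<close>. If \<open>d\<close> did not divide \<open>c\<close>, then
  \<open>d / gcd(d, c) > 1\<close> would divide all point multiplicities, and the coordinates could be permuted and
  rescaled to exhibit the code as a repetition (\<open>repetitive_if_balanced\<close>). So \<open>d\<close> divides
  \<open>c\<close>, and \<open>d = p ^ f\<close>. Finally, the sum of the weights of all codewords is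
    \<open>w1 * (q ^ k - 1) + d * b = n * (q ^ k - q ^ (k - 1))\<close>
  for some \<open>b\<close>; since \<open>d\<close> divides \<open>q ^ k\<close> and \<open>q ^ (k - 1)\<close>, it divides \<open>w1\<close>, which yields \<open>u\<close>.
\<close>

section \<open>Subspaces of finite vector spaces\<close>

lemma card_vectorspace:
  assumes "vectorspace (class_ring :: 'a::{field,finite} ring) V" and "finite (carrier V)"
  shows "card (carrier V) = CARD('a) ^ vectorspace.dim class_ring V"
proof -
  interpret V: vectorspace "class_ring :: 'a ring" V by fact
  have "V.fin_dim"
    unfolding V.fin_dim_def using assms(2) V.span_is_subset2[of "carrier V"] V.in_own_span[of "carrier V"]
    by blast
  then obtain B where B: "finite B" "V.basis B"
    using V.finite_basis_exists by blast
  have BV: "B \<subseteq> carrier V" using B(2) unfolding V.basis_def by simp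
  let ?E = "B \<rightarrow>\<^sub>E (UNIV :: 'a set)"
  have ex1: "\<And>v. v \<in> carrier V \<Longrightarrow> \<exists>!a. a \<in> ?E \<and> V.lincomb a B = v"
    using V.basis_criterion[OF B(1) BV] B(2) by (simp add: class_ring_simps)
  have cl: "V.lincomb a B \<in> carrier V" if "a \<in> ?E" for a
    using V.lincomb_closed[OF BV, of a] by (simp add: class_ring_simps)
  have "bij_betw (\<lambda>a. V.lincomb a B) ?E (carrier V)"
    unfolding bij_betw_def inj_on_def
  proof (intro conjI ballI impI equalityI subsetI)
    fix a b assume "a \<in> ?E" "b \<in> ?E" "V.lincomb a B = V.lincomb b B"
    then show "a = b" using ex1[OF cl] by metis
  next
    fix v assume "v \<in> carrier V"
    then show "v \<in> (\<lambda>a. V.lincomb a B) ` ?E" using ex1 by blast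
  qed (use cl in blast)
  then have "card (carrier V) = card ?E" by (simp add: bij_betw_same_card)
  also have "\<dots> = CARD('a) ^ card B" using B(1) by (simp add: card_PiE)
  finally show ?thesis using V.dim_basis[OF B] by simp
qed

lemma finite_carrier_vec: "finite (carrier_vec n :: 'a::finite vec set)"
proof (rule finite_subset)
  show "(carrier_vec n :: 'a vec set) \<subseteq> vec_of_list ` {xs. set xs \<subseteq> UNIV \<and> length xs = n}"
  proof
    fix x :: "'a vec" assume "x \<in> carrier_vec n"
    then show "x \<in> vec_of_list ` {xs. set xs \<subseteq> UNIV \<and> length xs = n}"
      by (intro image_eqI[of _ _ "list_of_vec x"]) (auto simp: vec_list)
  qed
  show "finite (vec_of_list ` {xs :: 'a list. set xs \<subseteq> UNIV \<and> length xs = n})"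
    by (intro finite_imageI finite_lists_length_eq) simp
qed

lemma card_carrier_vec: "card (carrier_vec n :: 'a::{field,finite} vec set) = CARD('a) ^ n"
proof -
  interpret vec_space "TYPE('a)" n .
  show ?thesis
    using card_vectorspace[OF vec_vs[where 'a='a and n=n]] dim_is_n finite_carrier_vec[of n]
    by simp
qed

lemma card_field_ge_2: "CARD('a::{field,finite}) \<ge> 2"
proof -
  have "card {0, 1 :: 'a} \<le> CARD('a)" by (rule card_mono) auto
  then show ?thesis by simp
qed

text \<open>
  Over a finite field the dimension of a subspace can be read off from its number of elements.
  Dimensions of codes and injectivity of parametrizations thereby become counting statements.
\<close>

lemma lin_subspace_iff_card:
  fixes W :: "'a::{field,finite} vec set"
  shows "lin_subspace n k W \<longleftrightarrow>
     W \<subseteq> carrier_vec n \<and> 0\<^sub>v n \<in> W \<and> (\<forall>x\<in>W. \<forall>y\<in>W. x + y \<in> W) \<and> (\<forall>a. \<forall>x\<in>W. a \<cdot>\<^sub>v x \<in> W) \<and>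
     card W = CARD('a) ^ k"
proof -
  interpret vec_space "TYPE('a)" n .
  have sub: "VectorSpace.subspace class_ring W (module_vec TYPE('a) n) \<longleftrightarrow>
     W \<subseteq> carrier_vec n \<and> 0\<^sub>v n \<in> W \<and> (\<forall>x\<in>W. \<forall>y\<in>W. x + y \<in> W) \<and> (\<forall>a. \<forall>x\<in>W. a \<cdot>\<^sub>v x \<in> W)"
    using module_axioms vec_vs[of n]
    unfolding VectorSpace.subspace_def submodule_def by (auto simp: module_vec_simps class_ring_simps)
  show ?thesis
  proof (cases "VectorSpace.subspace class_ring W (module_vec TYPE('a) n)")
    case True
    have "finite W" using sub True finite_carrier_vec finite_subset by blast
    then have "card W = CARD('a) ^ vectorspace.dim class_ring ((module_vec TYPE('a) n) \<lparr>carrier := W\<rparr>)"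
      using card_vectorspace[OF subspace_is_vs[OF True]] by simp
    then have "vectorspace.dim class_ring ((module_vec TYPE('a) n) \<lparr>carrier := W\<rparr>) = k
       \<longleftrightarrow> card W = CARD('a) ^ k"
      using card_field_ge_2[where 'a='a] by simp
    then show ?thesis using True sub unfolding lin_subspace_def by blast
  next
    case False
    then show ?thesis using sub unfolding lin_subspace_def by blast
  qed
qed

lemma span_singleton_vec:
  fixes v :: "'a::field vec"
  assumes "v \<in> carrier_vec k"
  shows "LinearCombinations.module.span class_ring (module_vec TYPE('a) k) {v} = range (\<lambda>a. a \<cdot>\<^sub>v v)"
proof -
  interpret vec_space "TYPE('a)" k .
  have "lincomb a {v} = a v \<cdot>\<^sub>v v" for a :: "'a vec \<Rightarrow> 'a"
    using assms by (simp add: lincomb_def)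
  moreover have "span {v} = {lincomb a {v} | a. True}"
    using finite_span[of "{v}"] assms by simp
  moreover have "\<exists>b. a = (b v :: 'a)" for a by (rule exI[of _ "\<lambda>_. a"]) simp
  ultimately show ?thesis by (auto simp: image_def)
qed

section \<open>Proportional vectors and affine subspaces\<close>

text \<open>
  For non-zero vectors this is equality of the projective points that they span. It is used for the
  columns of a generator matrix, so that the multiplicity of the point spanned by \<open>v\<close> is the number
  of columns proportional to \<open>v\<close>.
\<close>

definition proportional :: "'a::field vec \<Rightarrow> 'a vec \<Rightarrow> bool" where
  "proportional v w \<longleftrightarrow> (\<exists>c. c \<noteq> 0 \<and> w = c \<cdot>\<^sub>v v)"

lemma span_singleton_eq_iff:
  fixes v w :: "'a::field vec"
  assumes v: "v \<in> carrier_vec k" and w: "w \<in> carrier_vec k" "w \<noteq> 0\<^sub>v k"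
  shows "LinearCombinations.module.span class_ring (module_vec TYPE('a) k) {v} =
      LinearCombinations.module.span class_ring (module_vec TYPE('a) k) {w} \<longleftrightarrow> proportional v w"
  unfolding span_singleton_vec[OF v] span_singleton_vec[OF w(1)]
proof
  assume "range (\<lambda>a. a \<cdot>\<^sub>v v) = range (\<lambda>a. a \<cdot>\<^sub>v w)"
  moreover have "w = 1 \<cdot>\<^sub>v w" by simp
  ultimately obtain c where c: "w = c \<cdot>\<^sub>v v" by blast
  moreover have "c \<noteq> 0" using c w v by auto
  ultimately show "proportional v w" unfolding proportional_def by blast
next
  assume "proportional v w"
  then obtain c where c: "c \<noteq> 0" "w = c \<cdot>\<^sub>v v" unfolding proportional_def by blast
  have "a \<cdot>\<^sub>v v = (a / c) \<cdot>\<^sub>v w" "a \<cdot>\<^sub>v w = (a * c) \<cdot>\<^sub>v v" for a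
    using c by (simp_all add: smult_smult_assoc)
  then show "range (\<lambda>a. a \<cdot>\<^sub>v v) = range (\<lambda>a. a \<cdot>\<^sub>v w)" by blast
qed

lemma nonzero_vec_index:
  assumes "v \<in> carrier_vec k" "v \<noteq> 0\<^sub>v k"
  obtains i where "i < k" "v $ i \<noteq> 0"
  using assms by (metis carrier_vecD eq_vecI index_zero_vec(1,2))

text \<open>
  Two non-zero vectors all of whose \<open>2 \<times> 2\<close> minors vanish are proportional, with the quotient of two
  corresponding entries as factor.
\<close>

lemma not_proportional_minor:
  fixes v w :: "'a::field vec"
  assumes v: "v \<in> carrier_vec k" "v \<noteq> 0\<^sub>v k" and w: "w \<in> carrier_vec k" "w \<noteq> 0\<^sub>v k"
    and np: "\<not> proportional v w"
  obtains (minor) i j where "i < k" "j < k" "v $ i * w $ j - v $ j * w $ i \<noteq> 0"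
proof (rule ccontr)
  assume contra: "\<not> thesis"
  have eq: "v $ i * w $ j = v $ j * w $ i" if "i < k" "j < k" for i j
  proof (rule ccontr)
    assume "v $ i * w $ j \<noteq> v $ j * w $ i"
    then have "v $ i * w $ j - v $ j * w $ i \<noteq> 0" by simp
    then show False using that(1,2) contra minor by blast
  qed
  obtain r where r: "r < k" "v $ r \<noteq> 0" using nonzero_vec_index[OF v] .
  let ?c = "w $ r / v $ r"
  have "w $ j = ?c * v $ j" if "j < k" for j
    using eq[OF r(1) that] r(2) by (simp add: field_simps)
  then have w_eq: "w = ?c \<cdot>\<^sub>v v"
    using v(1) w(1) by (intro eq_vecI) auto
  have "?c \<noteq> 0"
  proof
    assume "?c = 0"
    then have "w = 0 \<cdot>\<^sub>v v" using w_eq by metis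
    also have "\<dots> = 0\<^sub>v k" using v(1) by (intro eq_vecI) auto
    finally show False using w(2) by simp
  qed
  then show False using np w_eq unfolding proportional_def by blast
qed

text \<open>
  The fibres of a surjective additive map are translates of each other, hence equally large.
\<close>

lemma card_fiber_additive:
  fixes f :: "'a::{field,finite} vec \<Rightarrow> 'b::{finite,ab_group_add}"
  assumes add: "\<And>x y. x \<in> carrier_vec k \<Longrightarrow> y \<in> carrier_vec k \<Longrightarrow> f (x + y) = f x + f y"
    and surj: "\<And>b. \<exists>x\<in>carrier_vec k. f x = b"
  shows "card {x \<in> carrier_vec k. f x = b} * CARD('b) = CARD('a) ^ k"
proof -
  let ?F = "\<lambda>b. {x \<in> carrier_vec k. f x = b}"
  \<comment> \<open>Translation by a preimage of \<open>b' - b\<close> maps one fibre into the other.\<close>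
  have le: "card (?F b) \<le> card (?F b')" for b b'
  proof -
    obtain z where z: "z \<in> carrier_vec k" "f z = b' - b" using surj by blast
    show ?thesis
    proof (rule card_inj_on_le)
      have "x = (x + z) - z" if "x \<in> carrier_vec k" for x
        using that z(1) by (intro eq_vecI) auto
      then show "inj_on (\<lambda>x. x + z) (?F b)"
        by (intro inj_onI) (metis (no_types, lifting) mem_Collect_eq)
      show "(\<lambda>x. x + z) ` ?F b \<subseteq> ?F b'" using z add by auto
      show "finite (?F b')" by (simp add: finite_carrier_vec)
    qed
  qed
  have "CARD('a) ^ k = card (\<Union>b\<in>UNIV. ?F b)"
    unfolding card_carrier_vec[symmetric] by (rule arg_cong[of _ _ card]) auto
  also have "\<dots> = (\<Sum>b\<in>UNIV. card (?F b))"
    by (intro card_UN_disjoint) (auto simp: finite_carrier_vec)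
  also have "\<dots> = (\<Sum>b'\<in>(UNIV :: 'b set). card (?F b))"
    using le by (intro sum.cong) (auto intro: antisym)
  finally show ?thesis by simp
qed

lemma card_affine_hyperplane:
  fixes v :: "'a::{field,finite} vec"
  assumes v: "v \<in> carrier_vec k" "v \<noteq> 0\<^sub>v k"
  shows "card {x \<in> carrier_vec k. v \<bullet> x = b} * CARD('a) = CARD('a) ^ k"
proof (rule card_fiber_additive)
  fix x y :: "'a vec" assume "x \<in> carrier_vec k" "y \<in> carrier_vec k"
  then show "v \<bullet> (x + y) = v \<bullet> x + v \<bullet> y" using v by (simp add: scalar_prod_add_distrib)
next
  fix b
  obtain i where i: "i < k" "v $ i \<noteq> 0" using nonzero_vec_index[OF v] .
  have "v \<bullet> ((b / v $ i) \<cdot>\<^sub>v unit_vec k i) = b" using v i by simp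
  then show "\<exists>x\<in>carrier_vec k. v \<bullet> x = b" by (metis smult_carrier_vec unit_vec_carrier)
qed

text \<open>
  A non-vanishing minor makes \<open>x \<mapsto> (v \<bullet> x, w \<bullet> x)\<close> surjective: Cramer's rule solves the system
  with a vector supported on the two coordinates of the minor.
\<close>

lemma card_affine_codim2:
  fixes v w :: "'a::{field,finite} vec"
  assumes v: "v \<in> carrier_vec k" "v \<noteq> 0\<^sub>v k" and w: "w \<in> carrier_vec k" "w \<noteq> 0\<^sub>v k"
    and np: "\<not> proportional v w"
  shows "card {x \<in> carrier_vec k. v \<bullet> x = a \<and> w \<bullet> x = b} * CARD('a) ^ 2 = CARD('a) ^ k"
proof -
  have "card {x \<in> carrier_vec k. (v \<bullet> x, w \<bullet> x) = (a, b)} * CARD('a \<times> 'a) = CARD('a) ^ k"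
  proof (rule card_fiber_additive)
    fix x y :: "'a vec" assume "x \<in> carrier_vec k" "y \<in> carrier_vec k"
    then show "(v \<bullet> (x + y), w \<bullet> (x + y)) = (v \<bullet> x, w \<bullet> x) + (v \<bullet> y, w \<bullet> y)"
      using v w by (simp add: scalar_prod_add_distrib)
  next
    fix c :: "'a \<times> 'a"
    obtain a b where c: "c = (a, b)" by (cases c)
    obtain i j where ij: "i < k" "j < k" and D: "v $ i * w $ j - v $ j * w $ i \<noteq> 0"
      using not_proportional_minor[OF v w np] .
    let ?D = "v $ i * w $ j - v $ j * w $ i"
    let ?s = "(a * w $ j - b * v $ j) / ?D" and ?t = "(b * v $ i - a * w $ i) / ?D"
    let ?x = "?s \<cdot>\<^sub>v unit_vec k i + ?t \<cdot>\<^sub>v unit_vec k j"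
    have "v \<bullet> ?x = ?s * v $ i + ?t * v $ j" "w \<bullet> ?x = ?s * w $ i + ?t * w $ j"
      using v w ij by (simp_all add: scalar_prod_add_distrib[of _ k])
    moreover have "?s * v $ i + ?t * v $ j = a * ?D / ?D"
      unfolding times_divide_eq_left add_divide_distrib[symmetric]
      by (rule arg_cong[of _ _ "\<lambda>z. z / ?D"]) (simp add: algebra_simps)
    moreover have "?s * w $ i + ?t * w $ j = b * ?D / ?D"
      unfolding times_divide_eq_left add_divide_distrib[symmetric]
      by (rule arg_cong[of _ _ "\<lambda>z. z / ?D"]) (simp add: algebra_simps)
    ultimately have "(v \<bullet> ?x, w \<bullet> ?x) = c" using D c by simp
    moreover have "?x \<in> carrier_vec k" by simp
    ultimately show "\<exists>x\<in>carrier_vec k. (v \<bullet> x, w \<bullet> x) = c" by blast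
  qed
  then show ?thesis by (simp add: power2_eq_square)
qed

section \<open>Weight sums\<close>

lemma sum_card_swap:
  assumes "finite A" "finite J"
  shows "(\<Sum>x\<in>A. card {j \<in> J. P x j}) = (\<Sum>j\<in>J. card {x \<in> A. P x j})"
  using sum.swap_restrict[OF assms, of "\<lambda>_ _. 1 :: nat" P] by simp

lemma card_filter_split:
  assumes "finite A"
  shows "card A = card {x \<in> A. P x} + card {x \<in> A. \<not> P x}"
proof -
  have "card ({x \<in> A. P x} \<union> {x \<in> A. \<not> P x}) = card {x \<in> A. P x} + card {x \<in> A. \<not> P x}"
    using assms by (intro card_Un_disjoint) auto
  moreover have "{x \<in> A. P x} \<union> {x \<in> A. \<not> P x} = A" by blast
  ultimately show ?thesis by simp
qed

text \<open>
  Here \<open>g\<close> lists the columns of a generator matrix and \<open>x\<close> runs over the messages with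
  \<open>v \<bullet> x = 1\<close>. By double counting, every column contributes the number of these \<open>x\<close> on which it does
  not vanish. A column proportional to \<open>v\<close> vanishes nowhere on the affine hyperplane, any other one
  on a subset of size \<open>c = q ^ (k - 2)\<close>, so the sum is governed by the multiplicity of \<open>v\<close>. Compared
  with the hyperplane \<open>v \<bullet> x = 0\<close>, the affine one avoids \<open>x = 0\<close> and the factor \<open>q - 1\<close> from scalars.
  The subtracted term \<open>n * c\<close> is moved to the left to stay within the natural numbers.
\<close>

lemma weight_sum_affine_hyperplane:
  fixes g :: "nat \<Rightarrow> 'a::{field,finite} vec"
  assumes g: "\<And>j. j < n \<Longrightarrow> g j \<in> carrier_vec k" "\<And>j. j < n \<Longrightarrow> g j \<noteq> 0\<^sub>v k"
    and v: "v \<in> carrier_vec k" "v \<noteq> 0\<^sub>v k"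
    and c: "c * CARD('a) ^ 2 = CARD('a) ^ k"
  shows "(\<Sum>x\<in>{x \<in> carrier_vec k. v \<bullet> x = 1}. card {j. j < n \<and> g j \<bullet> x \<noteq> 0}) + n * c
     = n * (CARD('a) * c) + card {j. j < n \<and> proportional v (g j)} * c"
proof -
  let ?q = "CARD('a)"
  let ?A = "{x \<in> carrier_vec k. v \<bullet> x = 1}"
  have finA: "finite ?A" by (simp add: finite_carrier_vec)
  have cardA: "card ?A = ?q * c"
  proof -
    have "card ?A * ?q = (?q * c) * ?q"
      using card_affine_hyperplane[OF v, of 1] c by (simp add: power2_eq_square mult_ac)
    then show ?thesis by simp
  qed
  have each: "card {x \<in> ?A. g j \<bullet> x \<noteq> 0} + c = ?q * c + (if proportional v (g j) then c else 0)"
    if j: "j < n" for j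
  proof (cases "proportional v (g j)")
    case True
    then obtain s where "s \<noteq> 0" "g j = s \<cdot>\<^sub>v v" unfolding proportional_def by blast
    then have "{x \<in> ?A. g j \<bullet> x \<noteq> 0} = ?A" using v by auto
    then show ?thesis using cardA True by simp
  next
    case False
    have eq: "{x \<in> ?A. g j \<bullet> x = 0} = {x \<in> carrier_vec k. v \<bullet> x = 1 \<and> g j \<bullet> x = 0}" by blast
    have "card {x \<in> ?A. g j \<bullet> x = 0} * ?q ^ 2 = c * ?q ^ 2"
      unfolding eq using card_affine_codim2[OF v g(1)[OF j] g(2)[OF j] False] c by metis
    then have "card {x \<in> ?A. g j \<bullet> x = 0} = c" by simp
    moreover have "card ?A = card {x \<in> ?A. g j \<bullet> x \<noteq> 0} + card {x \<in> ?A. g j \<bullet> x = 0}"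
      using card_filter_split[OF finA, of "\<lambda>x. g j \<bullet> x \<noteq> 0"] by simp
    ultimately show ?thesis using cardA False by simp
  qed
  have "(\<Sum>x\<in>?A. card {j. j < n \<and> g j \<bullet> x \<noteq> 0}) = (\<Sum>j<n. card {x \<in> ?A. g j \<bullet> x \<noteq> 0})"
    using sum_card_swap[OF finA finite_lessThan, of n "\<lambda>x j. g j \<bullet> x \<noteq> 0"] by simp
  then have "(\<Sum>x\<in>?A. card {j. j < n \<and> g j \<bullet> x \<noteq> 0}) + n * c
      = (\<Sum>j<n. card {x \<in> ?A. g j \<bullet> x \<noteq> 0} + c)"
    by (simp add: sum.distrib)
  also have "\<dots> = (\<Sum>j<n. ?q * c + (if proportional v (g j) then c else 0))"
    by (rule sum.cong[OF refl]) (use each in simp)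
  also have "\<dots> = n * (?q * c) + card {j. j < n \<and> proportional v (g j)} * c"
    by (simp add: sum.distrib sum.If_cases lessThan_def Collect_conj_eq)
  finally show ?thesis .
qed

text \<open>
  The average weight: each non-zero column vanishes on a proportion \<open>1/q\<close> of all messages.
\<close>

lemma weight_sum_total:
  fixes g :: "nat \<Rightarrow> 'a::{field,finite} vec"
  assumes g: "\<And>j. j < n \<Longrightarrow> g j \<in> carrier_vec k" "\<And>j. j < n \<Longrightarrow> g j \<noteq> 0\<^sub>v k"
    and c: "c * CARD('a) = CARD('a) ^ k"
  shows "(\<Sum>x\<in>carrier_vec k. card {j. j < n \<and> g j \<bullet> x \<noteq> 0}) + n * c = n * CARD('a) ^ k"
proof -
  let ?V = "carrier_vec k :: 'a vec set"
  have each: "card {x \<in> ?V. g j \<bullet> x \<noteq> 0} + c = CARD('a) ^ k" if j: "j < n" for j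
  proof -
    have "card {x \<in> ?V. g j \<bullet> x = 0} * CARD('a) = c * CARD('a)"
      using card_affine_hyperplane[OF g(1)[OF j] g(2)[OF j], of 0] c by simp
    then have "card {x \<in> ?V. g j \<bullet> x = 0} = c" by simp
    moreover have "card ?V = card {x \<in> ?V. g j \<bullet> x \<noteq> 0} + card {x \<in> ?V. g j \<bullet> x = 0}"
      using card_filter_split[OF finite_carrier_vec[of k], of "\<lambda>x. g j \<bullet> x \<noteq> 0"] by simp
    ultimately show ?thesis by (simp add: card_carrier_vec)
  qed
  have "(\<Sum>x\<in>?V. card {j. j < n \<and> g j \<bullet> x \<noteq> 0}) = (\<Sum>j<n. card {x \<in> ?V. g j \<bullet> x \<noteq> 0})"
    using sum_card_swap[OF finite_carrier_vec[of k] finite_lessThan, of n "\<lambda>x j. g j \<bullet> x \<noteq> 0"] by simp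
  then have "(\<Sum>x\<in>?V. card {j. j < n \<and> g j \<bullet> x \<noteq> 0}) + n * c
      = (\<Sum>j<n. card {x \<in> ?V. g j \<bullet> x \<noteq> 0} + c)"
    by (simp add: sum.distrib)
  also have "\<dots> = n * CARD('a) ^ k" using each by simp
  finally show ?thesis .
qed

lemma sum_two_values:
  fixes W :: "'b \<Rightarrow> nat"
  assumes "finite A" "\<And>x. x \<in> A \<Longrightarrow> W x \<in> {w1, w2}" "w1 \<le> w2"
  shows "\<exists>b. (\<Sum>x\<in>A. W x) = w1 * card A + (w2 - w1) * b"
proof -
  have "(\<Sum>x\<in>A. W x) = (\<Sum>x\<in>A. w1 + (w2 - w1) * (if W x = w2 then 1 else 0))"
    using assms(2,3) by (intro sum.cong) auto
  also have "\<dots> = w1 * card A + (w2 - w1) * (\<Sum>x\<in>A. if W x = w2 then 1 else 0)"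
    by (simp add: sum.distrib sum_distrib_left)
  finally show ?thesis by blast
qed

section \<open>Repetitive codes\<close>

text \<open>
  Removing \<open>l\<close> elements of a single \<open>\<kappa>\<close>-class preserves divisibility of all class sizes. Each removed
  batch becomes a row of a table with \<open>l\<close> columns, in which \<open>f (i, t)\<close> is entry \<open>t\<close> of row \<open>i\<close>.
\<close>

lemma balanced_arrangement:
  fixes \<kappa> :: "'i \<Rightarrow> 'b"
  assumes "finite S" and "l > 0" and "\<And>y. l dvd card {s \<in> S. \<kappa> s = y}"
  shows "\<exists>(m::nat) f. bij_betw f ({..<m} \<times> {..<l}) S \<and> (\<forall>i<m. \<forall>t<l. \<kappa> (f (i, t)) = \<kappa> (f (i, 0)))"
  using assms(1,3)
proof (induction S rule: finite_psubset_induct)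
  case (psubset S)
  show ?case
  proof (cases "S = {}")
    case True
    then show ?thesis by (intro exI[of _ "0::nat"]) (simp add: bij_betw_def)
  next
    case False
    then obtain x where x: "x \<in> S" by blast
    let ?K = "{s \<in> S. \<kappa> s = \<kappa> x}"
    have finK: "finite ?K" using psubset.hyps by simp
    have "card ?K > 0" using x finK by (auto simp: card_gt_0_iff)
    then have "l \<le> card ?K" using psubset.prems[of "\<kappa> x"] by (simp add: dvd_imp_le)
    then obtain T where T: "T \<subseteq> ?K" "card T = l"
      by (meson obtain_subset_with_card_n)
    have finT: "finite T" using T finK finite_subset by blast
    have "T \<noteq> {}" using T(2) assms(2) by auto
    then have "S - T \<subset> S" using T(1) by blast
    moreover have "l dvd card {s \<in> S - T. \<kappa> s = y}" for y
    proof (cases "y = \<kappa> x")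
      case True
      then have "{s \<in> S - T. \<kappa> s = y} = ?K - T" by blast
      then show ?thesis using card_Diff_subset[OF finT T(1)] T(2) psubset.prems[of "\<kappa> x"]
        by (simp add: dvd_diff_nat)
    next
      case False
      then have "{s \<in> S - T. \<kappa> s = y} = {s \<in> S. \<kappa> s = y}" using T(1) by blast
      then show ?thesis using psubset.prems by simp
    qed
    ultimately obtain m :: nat and f where f: "bij_betw f ({..<m} \<times> {..<l}) (S - T)"
      and fk: "\<forall>i<m. \<forall>t<l. \<kappa> (f (i, t)) = \<kappa> (f (i, 0))"
      using psubset.IH[of "S - T"] by blast
    obtain g where g: "bij_betw g {..<l} T"
      using ex_bij_betw_nat_finite[OF finT] T(2) by (auto simp: atLeast0LessThan)
    define h where "h = (\<lambda>(i, t). if i < m then f (i, t) else g t)"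
    have "bij_betw h ({..<m} \<times> {..<l}) (S - T)"
      using f by (rule bij_betw_cong[THEN iffD1, rotated]) (auto simp: h_def)
    moreover have "bij_betw h ({m} \<times> {..<l}) T"
    proof -
      have "bij_betw (g \<circ> snd) ({m} \<times> {..<l}) T"
        by (rule bij_betw_trans[OF _ g]) (auto simp: bij_betw_def inj_on_def)
      then show ?thesis by (rule bij_betw_cong[THEN iffD1, rotated]) (auto simp: h_def)
    qed
    ultimately have "bij_betw h (({..<m} \<times> {..<l}) \<union> ({m} \<times> {..<l})) ((S - T) \<union> T)"
      by (rule bij_betw_combine) blast
    also have "({..<m} \<times> {..<l}) \<union> ({m} \<times> {..<l}) = {..<Suc m} \<times> {..<l}" by auto
    also have "(S - T) \<union> T = S" using T(1) by blast
    finally have h: "bij_betw h ({..<Suc m} \<times> {..<l}) S" .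
    have "\<kappa> (h (i, t)) = \<kappa> (h (i, 0))" if "i < Suc m" "t < l" for i t
    proof (cases "i < m")
      case True
      then have "\<kappa> (f (i, t)) = \<kappa> (f (i, 0))" using fk that by blast
      then show ?thesis using True by (simp add: h_def)
    next
      case False
      have "g t \<in> T" "g 0 \<in> T"
        using bij_betwE[OF g] that(2) assms(2) by simp_all
      then have "\<kappa> (g t) = \<kappa> x" "\<kappa> (g 0) = \<kappa> x" using T(1) by blast+
      then show ?thesis using False by (simp add: h_def)
    qed
    then have "\<forall>i<Suc m. \<forall>t<l. \<kappa> (h (i, t)) = \<kappa> (h (i, 0))" by blast
    with h show ?thesis by blast
  qed
qed

text \<open>
  A table of the coordinates with rows of length \<open>l\<close> inside \<open>\<kappa>\<close>-classes yields the permutation \<open>\<pi>\<close>: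
  position \<open>r + m * t\<close> receives entry \<open>t\<close> of row \<open>r\<close>. As equally labelled coordinates are proportional
  on \<open>C\<close>, the \<open>l\<close> consecutive blocks of length \<open>m\<close> agree after rescaling. A codeword is determined by
  its first block, so the shorter code formed by these blocks has the same dimension.
\<close>

lemma repetitive_if_balanced:
  fixes C :: "'a::{field,finite} vec set" and \<kappa> :: "nat \<Rightarrow> 'b"
  assumes C: "linear_code n k C" and l: "l > 1"
    and balanced: "\<And>y. l dvd card {i. i < n \<and> \<kappa> i = y}"
    and par: "\<And>i j. i < n \<Longrightarrow> j < n \<Longrightarrow> \<kappa> i = \<kappa> j \<Longrightarrow> \<exists>c. c \<noteq> 0 \<and> (\<forall>x\<in>C. x $ j = c * x $ i)"
  shows "repetitive n k C"
proof -
  have Ccar: "C \<subseteq> carrier_vec n" and C0: "0\<^sub>v n \<in> C" and Cadd: "\<And>x y. x \<in> C \<Longrightarrow> y \<in> C \<Longrightarrow> x + y \<in> C"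
    and Csm: "\<And>a x. x \<in> C \<Longrightarrow> a \<cdot>\<^sub>v x \<in> C" and Ccard: "card C = CARD('a) ^ k"
    using C unfolding lin_subspace_iff_card by blast+
  have "l dvd card {s \<in> {..<n}. \<kappa> s = y}" for y using balanced[of y] by simp
  moreover have l_pos: "0 < l" using l by simp
  ultimately obtain m :: nat and f where f: "bij_betw f ({..<m} \<times> {..<l}) {..<n}"
    and fk: "\<forall>i<m. \<forall>t<l. \<kappa> (f (i, t)) = \<kappa> (f (i, 0))"
    using balanced_arrangement[OF finite_lessThan, of l n \<kappa>] l_pos by blast
  have n: "n = l * m" using bij_betw_same_card[OF f] by (simp add: mult.commute)
  have "bij_betw (\<lambda>i. (i mod m, i div m)) {..<n} ({..<m} \<times> {..<l})"
  proof (rule bij_betw_byWitness[where f' = "\<lambda>(r, t). r + m * t"])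
    show "(\<lambda>i. (i mod m, i div m)) ` {..<n} \<subseteq> {..<m} \<times> {..<l}"
      unfolding n by (auto simp: less_mult_imp_div_less intro!: mod_less_divisor gr0I)
    show "(\<lambda>(r, t). r + m * t) ` ({..<m} \<times> {..<l}) \<subseteq> {..<n}"
    proof clarsimp
      fix r t assume "r < m" "t < l"
      then have "r + m * t < m * Suc t" "m * Suc t \<le> m * l" by (simp, intro mult_le_mono) auto
      then show "r + m * t < n" unfolding n by (simp add: mult.commute)
    qed
  qed auto
  then have "bij_betw (\<lambda>i. f (i mod m, i div m)) {..<n} {..<n}"
    using bij_betw_trans[OF _ f] by (fastforce simp: comp_def)
  define \<pi> where "\<pi> i = (if i < n then f (i mod m, i div m) else i)" for i
  have \<pi>: "\<pi> permutes {..<n}"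
  proof (rule bij_imp_permutes)
    show "bij_betw \<pi> {..<n} {..<n}"
      using \<open>bij_betw (\<lambda>i. f (i mod m, i div m)) {..<n} {..<n}\<close>
      by (rule bij_betw_cong[THEN iffD1, rotated]) (simp add: \<pi>_def)
  qed (simp add: \<pi>_def)
  have \<pi>n: "\<pi> i < n" if "i < n" for i using permutes_in_image[OF \<pi>, of i] that by simp
  have modm: "i mod m < m" "i mod m < n" "i div m < l" if "i < n" for i
  proof -
    have "m > 0" using that n by (cases m) auto
    then show "i mod m < m" by simp
    show "i mod m < n" using that by (meson le_less_trans mod_less_eq_dividend)
    show "i div m < l" using that unfolding n by (simp add: less_mult_imp_div_less)
  qed
  \<comment> \<open>Position \<open>i mod m\<close> is the head, in the first block, of the row that contains position \<open>i\<close>.\<close>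
  have "\<kappa> (\<pi> i) = \<kappa> (\<pi> (i mod m))" if "i < n" for i
  proof -
    have "\<kappa> (f (i mod m, i div m)) = \<kappa> (f (i mod m, 0))" using fk modm[OF that] by blast
    then show ?thesis using modm[OF that] that by (simp add: \<pi>_def)
  qed
  then have "\<forall>i. \<exists>a. i < n \<longrightarrow> a \<noteq> 0 \<and> (\<forall>x\<in>C. x $ \<pi> (i mod m) = a * x $ \<pi> i)"
    using par \<pi>n modm(2) by metis
  then obtain a where a: "\<And>i. i < n \<Longrightarrow> a i \<noteq> 0"
      "\<And>i x. i < n \<Longrightarrow> x \<in> C \<Longrightarrow> x $ \<pi> (i mod m) = a i * x $ \<pi> i"
    by metis
  define R :: "'a vec \<Rightarrow> 'a vec" where "R x = vec m (\<lambda>i. x $ \<pi> i)" for x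
  have mn: "m \<le> n" using n l by (cases l) auto
  have R_inj: "inj_on R C"
  proof (rule inj_onI)
    fix x y assume x: "x \<in> C" and y: "y \<in> C" and eq: "R x = R y"
    have "x $ \<pi> i = y $ \<pi> i" if i: "i < n" for i
    proof -
      have "x $ \<pi> (i mod m) = y $ \<pi> (i mod m)"
        using arg_cong[OF eq, of "\<lambda>z. z $ (i mod m)"] modm(1)[OF i] by (simp add: R_def)
      then show ?thesis using a[OF i] x y by auto
    qed
    then have "x $ j = y $ j" if "j < n" for j
      using that permutes_inverses(1)[OF \<pi>, of j] permutes_in_image[OF permutes_inv[OF \<pi>], of j]
      by (metis lessThan_iff)
    then show "x = y" using subsetD[OF Ccar x] subsetD[OF Ccar y] by (intro eq_vecI) auto
  qed
  have "linear_code m k (R ` C)"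
    unfolding lin_subspace_iff_card
  proof (intro conjI)
    show "R ` C \<subseteq> carrier_vec m" by (auto simp: R_def)
    have "R (0\<^sub>v n) = 0\<^sub>v m" using \<pi>n mn by (intro eq_vecI) (auto simp: R_def)
    then show "0\<^sub>v m \<in> R ` C" using C0 by (metis imageI)
    have "R x + R y = R (x + y)" if "x \<in> C" "y \<in> C" for x y
      using \<pi>n mn subsetD[OF Ccar that(1)] subsetD[OF Ccar that(2)]
      by (intro eq_vecI) (auto simp: R_def)
    then show "\<forall>x\<in>R ` C. \<forall>y\<in>R ` C. x + y \<in> R ` C" using Cadd by auto
    have "b \<cdot>\<^sub>v R x = R (b \<cdot>\<^sub>v x)" if "x \<in> C" for b x
      using \<pi>n mn subsetD[OF Ccar that] by (intro eq_vecI) (auto simp: R_def)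
    then show "\<forall>b. \<forall>x\<in>R ` C. b \<cdot>\<^sub>v x \<in> R ` C" using Csm by auto
    show "card (R ` C) = CARD('a) ^ k" using card_image[OF R_inj] Ccard by simp
  qed
  moreover have "repeat_vec l (R x) = vec n (\<lambda>i. a i * x $ \<pi> i)" if "x \<in> C" for x
    using modm a(2)[OF _ that] unfolding repeat_vec_def
    by (intro eq_vecI) (auto simp: R_def n)
  then have "repeat_vec l ` R ` C = (\<lambda>x. vec n (\<lambda>i. a i * x $ \<pi> i)) ` C"
    unfolding image_image by (rule image_cong[OF refl])
  then have "code_equivalent n C (repeat_vec l ` R ` C)"
    unfolding code_equivalent_def using \<pi> a(1) by blast
  ultimately show ?thesis unfolding repetitive_def using l n by blast
qed

section \<open>Weights of non-repetitive two-weight codes\<close>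

text \<open>
  The witness \<open>l = d / gcd(d, c)\<close> is the part of \<open>d\<close> that \<open>c\<close> fails to account for. It replaces the
  greatest common divisor of all multiplicities \<open>N\<close> with \<open>d dvd N * c\<close>: it divides each of them, and if
  it is trivial then \<open>d\<close> itself divides \<open>c\<close>.
\<close>

lemma dvd_cofactor_or_one:
  fixes d c :: nat
  assumes "d > 0"
  obtains l where "l > 0" "l = 1 \<Longrightarrow> d dvd c" "\<And>N. d dvd N * c \<Longrightarrow> l dvd N"
proof (rule that[of "d div gcd d c"])
  let ?g = "gcd d c"
  have g: "?g > 0" using assms by simp
  have d: "d = (d div ?g) * ?g" by simp
  show "d div ?g > 0" using assms by (simp add: div_greater_zero_iff dvd_imp_le)
  show "d dvd c" if "d div ?g = 1"
  proof -
    have "d = ?g" using d that by simp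
    then show ?thesis by (metis gcd_dvd2)
  qed
  show "d div ?g dvd N" if "d dvd N * c" for N
  proof -
    have "d dvd gcd (N * d) (N * c)" using that by simp
    then have "(d div ?g) * ?g dvd N * ?g" using d by (metis gcd_mult_distrib_nat)
    then show ?thesis using nat_mult_dvd_cancel1[OF g, of "d div ?g" N] by (simp only: mult.commute)
  qed
qed

text \<open>
  A point of multiplicity zero is a one-dimensional subspace, hence spanned by any of its non-zero
  vectors, and no column is proportional to such a vector.
\<close>

lemma empty_point_obtains:
  fixes G :: "'a::{field,finite} mat"
  assumes G: "G \<in> carrier_mat k n" and cols: "\<And>j. j < n \<Longrightarrow> col G j \<noteq> 0\<^sub>v k"
    and nfs: "\<not> full_support G"
  obtains v where "v \<in> carrier_vec k" "v \<noteq> 0\<^sub>v k" "\<And>j. j < n \<Longrightarrow> \<not> proportional v (col G j)"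
proof -
  let ?span = "\<lambda>v :: 'a vec. LinearCombinations.module.span class_ring (module_vec TYPE('a) k) {v}"
  have dims: "dim_row G = k" "dim_col G = n" using G by auto
  obtain P where P: "lin_subspace k 1 P" and mult0: "point_multiplicity G P = 0"
    using nfs unfolding full_support_def pg_points_def dims by auto
  have no_col: "?span (col G j) \<noteq> P" if "j < n" for j
    using mult0 that unfolding point_multiplicity_def dims by simp
  have Pcar: "P \<subseteq> carrier_vec k" and Psm: "\<And>a x. x \<in> P \<Longrightarrow> a \<cdot>\<^sub>v x \<in> P" and Pcard: "card P = CARD('a)"
    using P unfolding lin_subspace_iff_card by auto
  have finP: "finite P" using Pcar finite_carrier_vec finite_subset by blast
  have "\<not> P \<subseteq> {0\<^sub>v k}"
  proof
    assume "P \<subseteq> {0\<^sub>v k}"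
    then have "card P \<le> 1" using card_mono[of "{0\<^sub>v k}" P] by simp
    then show False using Pcard card_field_ge_2[where 'a='a] by simp
  qed
  then obtain v where v: "v \<in> P" "v \<noteq> 0\<^sub>v k" by blast
  have vcar: "v \<in> carrier_vec k" using v Pcar by blast
  have "inj (\<lambda>a. a \<cdot>\<^sub>v v)"
  proof (rule injI)
    fix a b assume eq: "a \<cdot>\<^sub>v v = b \<cdot>\<^sub>v v"
    obtain i where i: "i < k" "v $ i \<noteq> 0" using nonzero_vec_index[OF vcar v(2)] .
    then show "a = b" using arg_cong[OF eq, of "\<lambda>z. z $ i"] vcar by simp
  qed
  then have "card (range (\<lambda>a. a \<cdot>\<^sub>v v)) = card P" using Pcard by (simp add: card_image)
  moreover have "range (\<lambda>a. a \<cdot>\<^sub>v v) \<subseteq> P" using Psm v(1) by blast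
  ultimately have "?span v = P"
    unfolding span_singleton_vec[OF vcar] using finP card_subset_eq by blast
  have "\<not> proportional v (col G j)" if j: "j < n" for j
  proof -
    have "col G j \<in> carrier_vec k" using G j by auto
    then show ?thesis
      using no_col[OF j] \<open>?span v = P\<close> span_singleton_eq_iff[OF vcar _ cols[OF j]] by metis
  qed
  then show thesis using that vcar v(2) by blast
qed

text \<open>
  Encoding \<open>x \<mapsto> G\<^sup>T x\<close> is onto the row space; since \<open>C\<close> has dimension \<open>k\<close>, it has as many elements as
  there are messages, so encoding is
  also injective.
\<close>

lemma codeword_parametrization:
  fixes G :: "'a::{field,finite} mat"
  assumes "generator_matrix n k G C"
  shows "C = (\<lambda>x. transpose_mat G *\<^sub>v x) ` carrier_vec k"
    and "\<And>x. x \<in> carrier_vec k \<Longrightarrow> x \<noteq> 0\<^sub>v k \<Longrightarrow> transpose_mat G *\<^sub>v x \<noteq> 0\<^sub>v n"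
    and "\<And>x j. x \<in> carrier_vec k \<Longrightarrow> j < n \<Longrightarrow> (transpose_mat G *\<^sub>v x) $ j = col G j \<bullet> x"
proof -
  interpret vec_space "TYPE('a)" n .
  have lin: "linear_code n k C" and G: "G \<in> carrier_mat k n" and row: "row_space G = C"
    using assms unfolding generator_matrix_def by auto
  let ?f = "\<lambda>x. transpose_mat G *\<^sub>v x"
  have Gt: "transpose_mat G \<in> carrier_mat n k" using G by simp
  show C: "C = ?f ` carrier_vec k"
    using row row_space_eq[OF G] G Gt by (auto simp: image_def)
  have "card (?f ` carrier_vec k) = card (carrier_vec k :: 'a vec set)"
    using lin C unfolding lin_subspace_iff_card card_carrier_vec by simp
  then have inj: "inj_on ?f (carrier_vec k)"
    by (rule eq_card_imp_inj_on[OF finite_carrier_vec])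
  show "?f x \<noteq> 0\<^sub>v n" if x: "x \<in> carrier_vec k" "x \<noteq> 0\<^sub>v k" for x
  proof
    assume "?f x = 0\<^sub>v n"
    also have "\<dots> = ?f (0\<^sub>v k)" using Gt by (intro eq_vecI) auto
    finally show False using inj x by (auto dest: inj_onD)
  qed
  show "?f x $ j = col G j \<bullet> x" if "x \<in> carrier_vec k" "j < n" for x j
    using that G by simp
qed

theorem theorem5p14:
  fixes C :: "'a::{field,finite} vec set" and G :: "'a mat"
    and p e q n k w1 w2 :: nat
  assumes "prime p" and "e \<ge> 1" and "q = p ^ e" and "CARD('a) = q"
    and "linear_code n k C"
    and "full_length n C"
    and "generator_matrix n k G C"
    and "two_weight_code n C"
    and "nonzero_weights n C = {w1, w2}" and "w1 < w2"
    and "\<not> repetitive n k C"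
    and "\<not> full_support G"
  shows "\<exists>f u :: nat. w1 = u * p ^ f \<and> w2 = (u + 1) * p ^ f"
proof -
  have G: "G \<in> carrier_mat k n" using assms(7) unfolding generator_matrix_def by blast
  note C = codeword_parametrization(1)[OF assms(7)]
    and nonzero = codeword_parametrization(2)[OF assms(7)]
    and coord = codeword_parametrization(3)[OF assms(7)]
  have gcar: "col G j \<in> carrier_vec k" if "j < n" for j using G that by auto
  have gnz: "col G j \<noteq> 0\<^sub>v k" if j: "j < n" for j
  proof
    assume z: "col G j = 0\<^sub>v k"
    have "c $ j = 0" if "c \<in> C" for c using that coord j z unfolding C by auto
    then show False using assms(6) j unfolding full_length_def by blast
  qed
  define W where "W x = card {j. j < n \<and> col G j \<bullet> x \<noteq> 0}" for x
  have W_weight: "W x = weight (transpose_mat G *\<^sub>v x)" if "x \<in> carrier_vec k" for x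
    unfolding W_def weight_def using coord[OF that] G by (intro arg_cong[of _ _ card]) auto
  have W_two: "W x \<in> {w1, w2}" if x: "x \<in> carrier_vec k" "x \<noteq> 0\<^sub>v k" for x
    unfolding W_weight[OF x(1)] assms(9)[symmetric] nonzero_weights_def
    using nonzero[OF x] x(1) unfolding C by blast
  have "n > 0"
  proof (rule ccontr)
    assume "\<not> n > 0"
    then have "weight c = 0" if "c \<in> C" for c
      using that G unfolding C weight_def by auto
    then have "nonzero_weights n C \<subseteq> {0}" unfolding nonzero_weights_def by auto
    then show False using assms(9,10) by auto
  qed
  define d where "d = w2 - w1"
  have "d > 0" using assms(10) by (simp add: d_def)
  \<comment> \<open>The missing point \<open>v0\<close> together with the first column shows \<open>q ^ 2 dvd q ^ k\<close>; the quotient is \<open>c\<close>.\<close>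
  obtain v0 where v0: "v0 \<in> carrier_vec k" "v0 \<noteq> 0\<^sub>v k" "\<And>j. j < n \<Longrightarrow> \<not> proportional v0 (col G j)"
    using empty_point_obtains[OF G gnz assms(12)] by blast
  define c where "c = card {x \<in> carrier_vec k. v0 \<bullet> x = 0 \<and> col G 0 \<bullet> x = 0}"
  have c: "c * CARD('a) ^ 2 = CARD('a) ^ k"
    unfolding c_def using card_affine_codim2[OF v0(1,2) gcar gnz v0(3)] \<open>n > 0\<close> by blast
  define N where "N v = card {j. j < n \<and> proportional v (col G j)}" for v
  \<comment> \<open>In a two-weight code the weight sum over \<open>v \<bullet> x = 1\<close> is also \<open>w1\<close> times the number of \<open>x\<close>, plus \<open>d\<close> for
      each \<open>x\<close> of weight \<open>w2\<close>.\<close>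
  have affine: "\<exists>b. w1 * (CARD('a) * c) + d * b + n * c = n * (CARD('a) * c) + N v * c"
    if v: "v \<in> carrier_vec k" "v \<noteq> 0\<^sub>v k" for v
  proof -
    let ?A = "{x \<in> carrier_vec k. v \<bullet> x = 1}"
    have "finite ?A" by (simp add: finite_carrier_vec)
    moreover have "W x \<in> {w1, w2}" if "x \<in> ?A" for x
    proof -
      have "x \<noteq> 0\<^sub>v k" using that v(1) by auto
      then show ?thesis using W_two that by blast
    qed
    ultimately obtain b where b: "(\<Sum>x\<in>?A. W x) = w1 * card ?A + d * b"
      unfolding d_def using sum_two_values[of ?A W w1 w2] assms(10) by auto
    have "card ?A * CARD('a) = (CARD('a) * c) * CARD('a)"
      using card_affine_hyperplane[OF v, of 1] c by (simp add: power2_eq_square mult_ac)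
    then have "card ?A = CARD('a) * c" by simp
    then have "w1 * (CARD('a) * c) + d * b + n * c = n * (CARD('a) * c) + N v * c"
      using b weight_sum_affine_hyperplane[of n "col G", OF gcar gnz v c] unfolding W_def N_def by simp
    then show ?thesis by blast
  qed
  have "N v0 = 0" using v0(3) by (simp add: N_def)
  then obtain b0 where b0: "w1 * (CARD('a) * c) + d * b0 + n * c = n * (CARD('a) * c)"
    using affine[OF v0(1,2)] by auto
  \<comment> \<open>Subtracting the equation of the empty point isolates the multiplicity of \<open>v\<close>.\<close>
  have d_dvd: "d dvd N v * c" if v: "v \<in> carrier_vec k" "v \<noteq> 0\<^sub>v k" for v
  proof -
    obtain b where "w1 * (CARD('a) * c) + d * b + n * c = n * (CARD('a) * c) + N v * c"
      using affine[OF v] by blast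
    then have "d * b = d * b0 + N v * c" using b0 by linarith
    then show ?thesis by (metis dvd_add_right_iff dvd_triv_left)
  qed
  obtain l where l: "l > 0" "l = 1 \<Longrightarrow> d dvd c" "\<And>N. d dvd N * c \<Longrightarrow> l dvd N"
    using dvd_cofactor_or_one[OF \<open>d > 0\<close>] by blast
  \<comment> \<open>A non-trivial \<open>l\<close> would divide the multiplicity of every point.\<close>
  have "\<not> l > 1"
  proof
    assume "l > 1"
    let ?\<kappa> = "\<lambda>j. LinearCombinations.module.span class_ring (module_vec TYPE('a) k) {col G j}"
    have \<kappa>: "?\<kappa> i = ?\<kappa> j \<longleftrightarrow> proportional (col G i) (col G j)" if "i < n" "j < n" for i j
      using span_singleton_eq_iff[OF gcar[OF that(1)] gcar[OF that(2)] gnz[OF that(2)]] .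
    have "repetitive n k C"
    proof (rule repetitive_if_balanced[OF assms(5) \<open>l > 1\<close>])
      fix y
      show "l dvd card {i. i < n \<and> ?\<kappa> i = y}"
      proof (cases "\<exists>i<n. ?\<kappa> i = y")
        case True
        then obtain i where i: "i < n" "?\<kappa> i = y" by blast
        have "{j. j < n \<and> ?\<kappa> j = y} = {j. j < n \<and> proportional (col G i) (col G j)}"
          using \<kappa>[OF i(1)] i(2) by metis
        then show ?thesis using l(3) d_dvd[OF gcar[OF i(1)] gnz[OF i(1)]] by (simp add: N_def)
      next
        case False
        then have "{i. i < n \<and> ?\<kappa> i = y} = {}" by blast
        then show ?thesis by (metis card.empty dvd_0_right)
      qed
    next
      fix i j assume ij: "i < n" "j < n" "?\<kappa> i = ?\<kappa> j"
      then obtain s where s: "s \<noteq> 0" "col G j = s \<cdot>\<^sub>v col G i"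
        using \<kappa> unfolding proportional_def by blast
      have "x $ j = s * x $ i" if "x \<in> C" for x
        using that coord ij s(2) gcar[OF ij(1)] unfolding C by auto
      then show "\<exists>c. c \<noteq> 0 \<and> (\<forall>x\<in>C. x $ j = c * x $ i)" using s(1) by blast
    qed
    then show False using assms(11) by blast
  qed
  then have "d dvd c" using l(1,2) by linarith
  then have d_dvd_qk: "d dvd CARD('a) ^ k" using c by (metis dvd_mult2)
  then have "d dvd p ^ (e * k)" using assms(3,4) by (simp add: power_mult)
  then obtain f where f: "d = p ^ f" using divides_primepow_nat[OF assms(1)] by blast
  \<comment> \<open>The sum of all weights determines \<open>w1 * (q ^ k - 1)\<close> modulo \<open>d\<close>, and \<open>d\<close> divides \<open>q ^ k\<close>.\<close>
  have "d dvd w1"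
  proof -
    let ?V = "carrier_vec k :: 'a vec set"
    let ?A = "?V - {0\<^sub>v k}"
    have "\<exists>b. (\<Sum>x\<in>?A. W x) = w1 * card ?A + d * b"
      unfolding d_def using W_two finite_carrier_vec[of k] assms(10) by (intro sum_two_values) auto
    then obtain b where b: "(\<Sum>x\<in>?A. W x) = w1 * card ?A + d * b" by blast
    have "W (0\<^sub>v k) = 0" using gcar by (simp add: W_def)
    then have "(\<Sum>x\<in>?V. W x) = (\<Sum>x\<in>?A. W x)"
      using sum.remove[OF finite_carrier_vec[of k], of "0\<^sub>v k" W] by simp
    then have "w1 * card ?A + d * b + n * (c * CARD('a)) = n * CARD('a) ^ k"
      using weight_sum_total[of n "col G" k "c * CARD('a)", OF gcar gnz] b c
      unfolding W_def by (simp add: power2_eq_square mult_ac)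
    moreover have "Suc (card ?A) = CARD('a) ^ k"
      using card_Suc_Diff1[OF finite_carrier_vec[of k], of "0\<^sub>v k"] card_carrier_vec[of k, where 'a='a] by simp
    ultimately have "w1 * CARD('a) ^ k + (d * b + n * (c * CARD('a))) = n * CARD('a) ^ k + w1"
      by (metis (no_types, lifting) add.commute add.left_commute mult_Suc_right)
    moreover have "d dvd w1 * CARD('a) ^ k + (d * b + n * (c * CARD('a)))"
      using d_dvd_qk \<open>d dvd c\<close> by simp
    moreover have "d dvd n * CARD('a) ^ k" using d_dvd_qk by simp
    ultimately show ?thesis using dvd_add_right_iff by metis
  qed
  then obtain u where "w1 = u * d" by (metis dvd_def mult.commute)
  moreover have "w2 = w1 + d" using assms(10) by (simp add: d_def)
  ultimately show ?thesis unfolding f by (intro exI[of _ f] exI[of _ u]) simp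
qed

end
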